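(* Let $n \geq 1$ be an integer. The $n$-dimensional hypercube $Q_n$ has an $L_{16}$-decomposition if and only if $n = 4$ or $n \geq 6$.
   Context: For a positive integer $n$, the hypercube $Q_n$ is the graph whose vertices are the binary strings $x_1x_2\cdots x_n$ ($x_i\in\{0,1\}$), two vertices being adjacent if and only if they differ in exactly one position. For an integer $k \geq 3$, the sunlet graph $L_{2k}$ is the graph obtained from a cycle $C_k$ of length $k$ by attaching one pendant edge (to a new vertex) at each vertex of the cycle; it has $2k$ vertices and $2k$ edges. For a graph $H$, an $H$-decomposition of a graph $G$ is a collection of edge-disjoint subgraphs of $G$, each isomorphic to $H$, whose edge sets partition $E(G)$. *)

theory Defs
  imports Main
begin

record 'a ugraph =
  verts :: "'a set"
  edges :: "'a set set"

definition simple_graph :: "'a ugraph \<Rightarrow> bool" where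
  "simple_graph G \<longleftrightarrow> (\<forall>e\<in>edges G. e \<subseteq> verts G \<and> card e = 2)"

definition subgraph :: "'a ugraph \<Rightarrow> 'a ugraph \<Rightarrow> bool" where
  "subgraph S G \<longleftrightarrow> simple_graph S \<and> verts S \<subseteq> verts G \<and> edges S \<subseteq> edges G"

definition isomorphic :: "'a ugraph \<Rightarrow> 'b ugraph \<Rightarrow> bool" where
  "isomorphic G H \<longleftrightarrow> (\<exists>f. bij_betw f (verts G) (verts H) \<and>
     (\<forall>u\<in>verts G. \<forall>v\<in>verts G. {u, v} \<in> edges G \<longleftrightarrow> {f u, f v} \<in> edges H))"

definition is_decomposition :: "'b ugraph \<Rightarrow> 'a ugraph \<Rightarrow> 'a ugraph set \<Rightarrow> bool" where
  "is_decomposition H G \<D> \<longleftrightarrow>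
     (\<forall>S\<in>\<D>. subgraph S G \<and> isomorphic S H) \<and>
     (\<forall>S\<in>\<D>. \<forall>T\<in>\<D>. S \<noteq> T \<longrightarrow> edges S \<inter> edges T = {}) \<and>
     (\<Union>S\<in>\<D>. edges S) = edges G"

definition has_decomposition :: "'b ugraph \<Rightarrow> 'a ugraph \<Rightarrow> bool" where
  "has_decomposition H G \<longleftrightarrow> (\<exists>\<D>. is_decomposition H G \<D>)"

definition hypercube :: "nat \<Rightarrow> bool list ugraph" where
  "hypercube n = \<lparr>
     verts = {x. length x = n},
     edges = {{x, y} | x y. length x = n \<and> length y = n \<and> (\<exists>!i. i < n \<and> x ! i \<noteq> y ! i)}\<rparr>"

text \<open>
  \<open>sunlet k\<close> is $L_{2k}$ (for $k \ge 3$): the cycle runs through the vertices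
  \<open>(i, False)\<close>, and \<open>(i, True)\<close> is the pendant vertex attached to \<open>(i, False)\<close>.
\<close>

definition sunlet :: "nat \<Rightarrow> (nat \<times> bool) ugraph" where
  "sunlet k = \<lparr>
     verts = {..<k} \<times> UNIV,
     edges = {{(i, False), (Suc i mod k, False)} | i. i < k}
           \<union> {{(i, False), (i, True)} | i. i < k}\<rparr>"

lemma simple_graph_hypercube: "simple_graph (hypercube n)"
  by (auto simp: simple_graph_def hypercube_def card_2_iff)

lemma simple_graph_sunlet:
  assumes "k \<ge> 3"
  shows "simple_graph (sunlet k)"
proof -
  have "Suc i mod k \<noteq> i \<and> Suc i mod k < k" if "i < k" for i
    using that assms by (cases "Suc i = k") auto
  then show ?thesis
    by (fastforce simp: simple_graph_def sunlet_def card_2_iff)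
qed

end

theory Submission
  imports Defs
begin

text \<open>
  Necessity: a decomposition of $Q_n$ has $n 2^{n-1} / 16$ members, which is not an integer for
  $n \le 3$. For $n = 5$ it has 5 members. Every vertex on the cycle of a sunlet has degree 3
  there, so a vertex of $Q_5$ lies on at most one of the 5 cycles; but $5 \cdot 8 > 32$.

  Sufficiency: as $Q_{m+n}$ is the Cartesian product of $Q_m$ and $Q_n$, decompositions of $Q_m$
  and $Q_n$ give one of $Q_{m+n}$, so $n = 4, 6, 7, 9$ suffice. For these, take all translates of
  a few explicit sunlets by a binary linear code. Two vertices are translates of each other iff
  their syndromes agree. Hence every edge of direction $i$ occurs exactly once if the syndromes of
  the end points of the explicit edges of direction $i$ run through all syndromes exactly once.
\<close>

subsection \<open>Isomorphisms and images of graphs\<close>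

lemma image_mem_image_image_iff:
  assumes "inj_on f A" "E \<subseteq> Pow A" "d \<subseteq> A"
  shows "f ` d \<in> image f ` E \<longleftrightarrow> d \<in> E"
  using assms by (intro inj_on_image_mem_iff[where B = "Pow A"] inj_on_image_Pow) auto

definition image_graph :: "('a \<Rightarrow> 'b) \<Rightarrow> 'a ugraph \<Rightarrow> 'b ugraph" where
  "image_graph f G = \<lparr>verts = f ` verts G, edges = image f ` edges G\<rparr>"

lemma verts_image_graph [simp]: "verts (image_graph f G) = f ` verts G"
  and edges_image_graph [simp]: "edges (image_graph f G) = image f ` edges G"
  by (simp_all add: image_graph_def)

lemma simple_graphD:
  assumes "simple_graph G" "e \<in> edges G"
  shows "e \<subseteq> verts G" "card e = 2"
  using assms by (auto simp: simple_graph_def)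

lemma simple_graph_edgeE:
  assumes "simple_graph G" "e \<in> edges G"
  obtains u v where "e = {u, v}" "u \<in> verts G" "v \<in> verts G"
  using simple_graphD[OF assms] by (auto simp: card_2_iff)

lemma simple_graph_image_graph:
  assumes "simple_graph G" "inj_on f (verts G)"
  shows "simple_graph (image_graph f G)"
  using assms by (auto simp: simple_graph_def card_image[OF inj_on_subset[OF assms(2)]])

lemma inj_on_image_edges:
  assumes "simple_graph G" "inj_on f (verts G)"
  shows "inj_on (image f) (edges G)"
  using inj_on_image_Pow[OF assms(2)]
  by (rule inj_on_subset) (use simple_graphD(1)[OF assms(1)] in auto)

lemma isomorphic_sym:
  assumes "isomorphic G H"
  shows "isomorphic H G"
proof -
  obtain f where f: "bij_betw f (verts G) (verts H)"
    and edge: "\<And>u v. u \<in> verts G \<Longrightarrow> v \<in> verts G \<Longrightarrow> {u, v} \<in> edges G \<longleftrightarrow> {f u, f v} \<in> edges H"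
    using assms by (auto simp: isomorphic_def)
  let ?g = "inv_into (verts G) f"
  have g: "?g a \<in> verts G" "f (?g a) = a" if "a \<in> verts H" for a
    using f that by (auto simp: bij_betw_def inv_into_into f_inv_into_f)
  show ?thesis
    unfolding isomorphic_def
    by (rule exI[of _ ?g]) (simp add: bij_betw_inv_into f edge g)
qed

lemma isomorphic_trans:
  assumes "isomorphic G H" "isomorphic H K"
  shows "isomorphic G K"
proof -
  obtain f g where f: "bij_betw f (verts G) (verts H)" and g: "bij_betw g (verts H) (verts K)"
    and "\<And>u v. u \<in> verts G \<Longrightarrow> v \<in> verts G \<Longrightarrow> {u, v} \<in> edges G \<longleftrightarrow> {f u, f v} \<in> edges H"
    and "\<And>u v. u \<in> verts H \<Longrightarrow> v \<in> verts H \<Longrightarrow> {u, v} \<in> edges H \<longleftrightarrow> {g u, g v} \<in> edges K"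
    using assms by (auto simp: isomorphic_def)
  then show ?thesis
    unfolding isomorphic_def
    by (intro exI[of _ "g \<circ> f"]) (simp add: bij_betw_trans[OF f g] bij_betwE[OF f])
qed

lemma isomorphic_image_graph:
  assumes "simple_graph G" "inj_on f (verts G)"
  shows "isomorphic (image_graph f G) G"
proof (rule isomorphic_sym)
  have edges: "edges G \<subseteq> Pow (verts G)" using simple_graphD(1)[OF assms(1)] by auto
  show "isomorphic G (image_graph f G)"
    unfolding isomorphic_def
    using image_mem_image_image_iff[OF assms(2) edges, of "{u, v}" for u v] assms(2)
    by (intro exI[of _ f]) (auto simp: bij_betw_def)
qed

lemma isomorphic_imp_image_graph:
  assumes "isomorphic G H" and G: "simple_graph G" and H: "simple_graph H"
  obtains f where "inj_on f (verts G)" "H = image_graph f G"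
proof -
  obtain f where f: "bij_betw f (verts G) (verts H)"
    and edge: "\<And>u v. u \<in> verts G \<Longrightarrow> v \<in> verts G \<Longrightarrow> {u, v} \<in> edges G \<longleftrightarrow> {f u, f v} \<in> edges H"
    using assms(1) by (auto simp: isomorphic_def)
  have "edges H = image f ` edges G"
  proof (intro equalityI subsetI)
    fix e assume e: "e \<in> edges H"
    then obtain a b where "e = {a, b}" "a \<in> verts H" "b \<in> verts H"
      using H by (auto elim: simple_graph_edgeE)
    moreover obtain u v where "a = f u" "b = f v" "u \<in> verts G" "v \<in> verts G"
      using f calculation by (metis bij_betw_imp_surj_on imageE)
    ultimately have "{u, v} \<in> edges G" "e = f ` {u, v}" using e edge by simp_all
    then show "e \<in> image f ` edges G" by blast
  next
    fix e assume "e \<in> image f ` edges G"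
    then obtain u v where "e = f ` {u, v}" "{u, v} \<in> edges G" "u \<in> verts G" "v \<in> verts G"
      using G by (auto elim!: simple_graph_edgeE)
    then show "e \<in> edges H" using edge by simp
  qed
  then have "H = image_graph f G"
    using f by (simp add: image_graph_def bij_betw_def)
  then show thesis using that f by (auto simp: bij_betw_def)
qed

subsection \<open>Degrees\<close>

definition degree :: "'a ugraph \<Rightarrow> 'a \<Rightarrow> nat" where
  "degree G v = card {e \<in> edges G. v \<in> e}"

lemma finite_edges:
  assumes "simple_graph G" "finite (verts G)"
  shows "finite (edges G)"
  using assms by (auto simp: simple_graph_def intro: finite_subset[of _ "Pow (verts G)"])

lemma sum_degree_eq:
  assumes "simple_graph G" "finite (verts G)"
  shows "(\<Sum>v\<in>verts G. degree G v) = 2 * card (edges G)"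
  unfolding degree_def
proof (rule sum_multicount[OF assms(2) finite_edges[OF assms]], rule ballI)
  fix e assume "e \<in> edges G"
  then have "{v \<in> verts G. v \<in> e} = e" "card e = 2"
    using simple_graphD[OF assms(1)] by auto
  then show "card {v \<in> verts G. v \<in> e} = 2" by simp
qed

lemma degree_image_graph:
  assumes G: "simple_graph G" and f: "inj_on f (verts G)" and v: "v \<in> verts G"
  shows "degree (image_graph f G) (f v) = degree G v"
proof -
  have "f v \<in> f ` e \<longleftrightarrow> v \<in> e" if "e \<in> edges G" for e
    using inj_on_image_mem_iff[OF f v] simple_graphD(1)[OF G that] by simp
  then have "{e \<in> edges (image_graph f G). f v \<in> e} = image f ` {e \<in> edges G. v \<in> e}"
    by auto
  moreover have "inj_on (image f) {e \<in> edges G. v \<in> e}"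
    using inj_on_image_edges[OF G f] by (rule inj_on_subset) simp
  ultimately show ?thesis by (simp add: degree_def card_image)
qed

lemma isomorphic_card_edges:
  assumes "isomorphic G H" "simple_graph G" "simple_graph H"
  shows "card (edges G) = card (edges H)"
  using assms by (elim isomorphic_imp_image_graph) (simp_all add: card_image inj_on_image_edges)

lemma isomorphic_card_verts_degree:
  assumes "isomorphic G H" "simple_graph G" "simple_graph H"
  shows "card {v \<in> verts G. P (degree G v)} = card {v \<in> verts H. P (degree H v)}"
proof -
  obtain f where f: "inj_on f (verts G)" "H = image_graph f G"
    using assms by (rule isomorphic_imp_image_graph)
  have "{v \<in> verts H. P (degree H v)} = f ` {v \<in> verts G. P (degree G v)}"
    using f assms(2) by (auto simp: degree_image_graph)
  moreover have "inj_on f {v \<in> verts G. P (degree G v)}"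
    using f(1) by (rule inj_on_subset) simp
  ultimately show ?thesis by (simp add: card_image)
qed

subsection \<open>Counting in decompositions\<close>

lemma is_decompositionD:
  assumes "is_decomposition H G D"
  shows "S \<in> D \<Longrightarrow> subgraph S G"
    and "S \<in> D \<Longrightarrow> isomorphic S H"
    and "S \<in> D \<Longrightarrow> T \<in> D \<Longrightarrow> S \<noteq> T \<Longrightarrow> edges S \<inter> edges T = {}"
    and "(\<Union>S\<in>D. edges S) = edges G"
  using assms unfolding is_decomposition_def by blast+

lemma is_decomposition_imp_simple_graph:
  assumes D: "is_decomposition H G D"
  shows "simple_graph G"
  unfolding simple_graph_def
proof
  fix e assume "e \<in> edges G"
  then obtain S where "S \<in> D" "e \<in> edges S" using is_decompositionD(4)[OF D] by auto
  then show "e \<subseteq> verts G \<and> card e = 2"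
    using is_decompositionD(1)[OF D] by (fastforce simp: subgraph_def simple_graph_def)
qed

lemma finite_decomposition:
  assumes D: "is_decomposition H G D" and "finite (verts G)"
  shows "finite D"
proof (rule finite_imageD)
  show "finite ((\<lambda>S. (verts S, edges S)) ` D)"
  proof (rule finite_subset)
    show "(\<lambda>S. (verts S, edges S)) ` D \<subseteq> Pow (verts G) \<times> Pow (edges G)"
      using is_decompositionD(1)[OF D] by (auto simp: subgraph_def)
    show "finite (Pow (verts G) \<times> Pow (edges G))"
      using is_decomposition_imp_simple_graph[OF D] assms(2) by (simp add: finite_edges)
  qed
  show "inj_on (\<lambda>S. (verts S, edges S)) D" by (rule inj_onI) simp
qed

lemma card_edges_decomposition:
  assumes D: "is_decomposition H G D" and H: "simple_graph H" and G: "finite (verts G)"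
  shows "card (edges G) = card D * card (edges H)"
proof -
  have fin: "finite (edges S)" if "S \<in> D" for S
    using is_decompositionD(1)[OF D that] G
    by (auto simp: subgraph_def intro: finite_subset finite_edges)
  have "card (edges G) = (\<Sum>S\<in>D. card (edges S))"
    unfolding is_decompositionD(4)[OF D, symmetric]
    using finite_decomposition[OF D G] fin is_decompositionD(3)[OF D]
    by (intro card_UN_disjoint) auto
  also have "\<dots> = (\<Sum>S\<in>D. card (edges H))"
    using is_decompositionD(1,2)[OF D] H
    by (intro sum.cong isomorphic_card_edges) (auto simp: subgraph_def)
  finally show ?thesis by simp
qed

lemma degree_add_le_if_edge_disjoint:
  assumes "edges S \<inter> edges T = {}" "edges S \<subseteq> edges G" "edges T \<subseteq> edges G" "finite (edges G)"
  shows "degree S v + degree T v \<le> degree G v"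
proof -
  let ?E = "\<lambda>K. {e \<in> edges K. v \<in> e}"
  have fin: "finite (edges S)" "finite (edges T)"
    using assms by (auto intro: finite_subset)
  have "card (?E S) + card (?E T) = card (?E S \<union> ?E T)"
    using assms(1) fin by (intro card_Un_disjoint[symmetric]) auto
  also have "\<dots> \<le> card (?E G)"
    using assms(2-4) by (intro card_mono) auto
  finally show ?thesis by (simp add: degree_def)
qed

lemma card_decomposition_mult_high_degree_le:
  assumes D: "is_decomposition H G D" and H: "simple_graph H" and G: "finite (verts G)"
    and low: "\<And>v. v \<in> verts G \<Longrightarrow> degree G v < 2 * d"
  shows "card D * card {v \<in> verts H. d \<le> degree H v} \<le> card (verts G)"
proof -
  let ?high = "\<lambda>S. {v \<in> verts S. d \<le> degree S v}"
  have finG: "finite (edges G)"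
    using is_decomposition_imp_simple_graph[OF D] G by (rule finite_edges)
  have sub: "verts S \<subseteq> verts G" "edges S \<subseteq> edges G" "simple_graph S" if "S \<in> D" for S
    using is_decompositionD(1)[OF D that] by (auto simp: subgraph_def)
  have disj: "?high S \<inter> ?high T = {}" if ST: "S \<in> D" "T \<in> D" "S \<noteq> T" for S T
  proof (rule ccontr)
    assume "?high S \<inter> ?high T \<noteq> {}"
    then obtain v where v: "v \<in> verts S" "d \<le> degree S v" "d \<le> degree T v" by auto
    moreover have "degree S v + degree T v \<le> degree G v"
      using is_decompositionD(3)[OF D ST] sub(2) ST finG
      by (intro degree_add_le_if_edge_disjoint)
    ultimately show False using low[of v] sub(1)[OF ST(1)] by auto
  qed
  have "card (?high S) = card (?high H)" if "S \<in> D" for S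
    using is_decompositionD(2)[OF D that] sub(3)[OF that] H by (rule isomorphic_card_verts_degree)
  then have "card D * card (?high H) = (\<Sum>S\<in>D. card (?high S))" by simp
  also have "\<dots> = card (\<Union>S\<in>D. ?high S)"
    using finite_decomposition[OF D G] sub(1) G disj
    by (intro card_UN_disjoint[symmetric]) (auto intro: finite_subset)
  also have "\<dots> \<le> card (verts G)"
    using sub(1) G by (intro card_mono) auto
  finally show ?thesis .
qed

subsection \<open>Constructing decompositions\<close>

lemma has_decomposition_if_isomorphic:
  assumes "simple_graph G" "isomorphic G H"
  shows "has_decomposition H G"
  unfolding has_decomposition_def is_decomposition_def
  using assms by (intro exI[of _ "{G}"]) (auto simp: subgraph_def)

lemma has_decomposition_UN:
  assumes dec: "\<And>i. i \<in> I \<Longrightarrow> has_decomposition H (G i)"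
    and verts: "\<And>i. i \<in> I \<Longrightarrow> verts (G i) \<subseteq> verts K"
    and disj: "\<And>i j. i \<in> I \<Longrightarrow> j \<in> I \<Longrightarrow> i \<noteq> j \<Longrightarrow> edges (G i) \<inter> edges (G j) = {}"
    and edges: "(\<Union>i\<in>I. edges (G i)) = edges K"
  shows "has_decomposition H K"
proof -
  obtain D where D: "\<And>i. i \<in> I \<Longrightarrow> is_decomposition H (G i) (D i)"
    using dec unfolding has_decomposition_def by metis
  have "is_decomposition H K (\<Union>i\<in>I. D i)"
    unfolding is_decomposition_def
  proof (intro conjI ballI impI)
    fix S assume "S \<in> (\<Union>i\<in>I. D i)"
    then obtain i where i: "i \<in> I" "S \<in> D i" by auto
    then show "subgraph S K"
      using is_decompositionD(1)[OF D] verts edges unfolding subgraph_def by blast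
    show "isomorphic S H" using is_decompositionD(2)[OF D] i by simp
  next
    fix S T assume "S \<in> (\<Union>i\<in>I. D i)" "T \<in> (\<Union>i\<in>I. D i)" and "S \<noteq> T"
    then obtain i j where ij: "i \<in> I" "S \<in> D i" "j \<in> I" "T \<in> D j" by auto
    show "edges S \<inter> edges T = {}"
    proof (cases "i = j")
      case True
      then show ?thesis using is_decompositionD(3)[OF D] ij \<open>S \<noteq> T\<close> by simp
    next
      case False
      then show ?thesis using disj is_decompositionD(4)[OF D] ij by blast
    qed
  next
    show "(\<Union>S\<in>\<Union>i\<in>I. D i. edges S) = edges K"
      using is_decompositionD(4)[OF D] edges by auto
  qed
  then show ?thesis by (auto simp: has_decomposition_def)
qed

lemma has_decomposition_image_graph:
  assumes "has_decomposition H G" and f: "inj_on f (verts G)"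
  shows "has_decomposition H (image_graph f G)"
proof -
  obtain D where D: "is_decomposition H G D"
    using assms(1) by (auto simp: has_decomposition_def)
  have sub: "verts S \<subseteq> verts G" "edges S \<subseteq> edges G" "simple_graph S" if "S \<in> D" for S
    using is_decompositionD(1)[OF D that] by (auto simp: subgraph_def)
  have inj: "inj_on (image f) (edges G)"
    using is_decomposition_imp_simple_graph[OF D] f by (rule inj_on_image_edges)
  show ?thesis
  proof (rule has_decomposition_UN[where I = D and G = "image_graph f"])
    fix S assume S: "S \<in> D"
    have "inj_on f (verts S)" using f sub(1)[OF S] by (rule inj_on_subset)
    then show "has_decomposition H (image_graph f S)"
      using sub(3)[OF S] is_decompositionD(2)[OF D S]
        simple_graph_image_graph isomorphic_image_graph
      by (metis has_decomposition_if_isomorphic isomorphic_trans)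
    show "verts (image_graph f S) \<subseteq> verts (image_graph f G)" using sub(1)[OF S] by auto
  next
    fix S T assume "S \<in> D" "T \<in> D" "S \<noteq> T"
    then show "edges (image_graph f S) \<inter> edges (image_graph f T) = {}"
      using is_decompositionD(3)[OF D] sub(2) by (simp add: inj_on_image_Int[OF inj, symmetric])
  next
    show "(\<Union>S\<in>D. edges (image_graph f S)) = edges (image_graph f G)"
      by (simp add: image_UN[symmetric] is_decompositionD(4)[OF D])
  qed
qed

definition cartesian_product :: "'a ugraph \<Rightarrow> 'b ugraph \<Rightarrow> ('a \<times> 'b) ugraph" where
  "cartesian_product G H = \<lparr>verts = verts G \<times> verts H,
     edges = (\<Union>w\<in>verts H. edges (image_graph (\<lambda>v. (v, w)) G)) \<union>
       (\<Union>v\<in>verts G. edges (image_graph (Pair v) H))\<rparr>"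

lemma verts_cartesian_product [simp]: "verts (cartesian_product G H) = verts G \<times> verts H"
  by (simp add: cartesian_product_def)

lemma edge_cartesian_product_leftI:
  "d \<in> edges G \<Longrightarrow> w \<in> verts H \<Longrightarrow> (\<lambda>v. (v, w)) ` d \<in> edges (cartesian_product G H)"
  by (simp add: cartesian_product_def) blast

lemma edge_cartesian_product_rightI:
  "v \<in> verts G \<Longrightarrow> d \<in> edges H \<Longrightarrow> Pair v ` d \<in> edges (cartesian_product G H)"
  by (simp add: cartesian_product_def) blast

lemma edge_cartesian_productE:
  assumes "e \<in> edges (cartesian_product G H)"
  obtains w d where "w \<in> verts H" "d \<in> edges G" "e = (\<lambda>v. (v, w)) ` d"
  | v d where "v \<in> verts G" "d \<in> edges H" "e = Pair v ` d"
  using assms unfolding cartesian_product_def by auto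

lemma edge_left_layer_projections:
  assumes "simple_graph G" "e \<in> edges (image_graph (\<lambda>v. (v, w)) G)"
  shows "card (fst ` e) = 2 \<and> snd ` e = {w}"
proof -
  obtain d where d: "d \<in> edges G" "e = (\<lambda>v. (v, w)) ` d" using assms(2) by auto
  then have "card d = 2" "d \<noteq> {}" using assms(1) by (auto dest: simple_graphD)
  then show ?thesis by (auto simp: d(2) image_image)
qed

lemma edge_right_layer_projections:
  assumes "simple_graph H" "e \<in> edges (image_graph (Pair v) H)"
  shows "card (snd ` e) = 2 \<and> fst ` e = {v}"
proof -
  obtain d where d: "d \<in> edges H" "e = Pair v ` d" using assms(2) by auto
  then have "card d = 2" "d \<noteq> {}" using assms(1) by (auto dest: simple_graphD)
  then show ?thesis by (auto simp: d(2) image_image)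
qed

lemma has_decomposition_cartesian_product:
  assumes dec: "has_decomposition K G" "has_decomposition K H"
  shows "has_decomposition K (cartesian_product G H)"
proof (rule has_decomposition_UN)
  let ?I = "verts H <+> verts G"
  let ?layer = "case_sum (\<lambda>w. image_graph (\<lambda>v. (v, w)) G) (\<lambda>v. image_graph (Pair v) H)"
  have simple: "simple_graph G" "simple_graph H"
    using dec is_decomposition_imp_simple_graph by (auto simp: has_decomposition_def)
  show "has_decomposition K (?layer i)" if "i \<in> ?I" for i
    using that dec by (auto intro!: has_decomposition_image_graph inj_onI)
  show "verts (?layer i) \<subseteq> verts (cartesian_product G H)" if "i \<in> ?I" for i
    using that by auto
  show "edges (?layer i) \<inter> edges (?layer j) = {}" if "i \<in> ?I" "j \<in> ?I" "i \<noteq> j" for i j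
  proof (rule ccontr)
    assume "edges (?layer i) \<inter> edges (?layer j) \<noteq> {}"
    then obtain e where "e \<in> edges (?layer i)" "e \<in> edges (?layer j)" by blast
    then show False
      using \<open>i \<noteq> j\<close> by (cases i; cases j) (auto simp del: edges_image_graph
        dest!: edge_left_layer_projections[OF simple(1)] edge_right_layer_projections[OF simple(2)])
  qed
  show "(\<Union>i\<in>?I. edges (?layer i)) = edges (cartesian_product G H)"
    by (simp add: cartesian_product_def Plus_def)
qed

subsection \<open>Hypercubes\<close>

definition flip :: "nat \<Rightarrow> bool list \<Rightarrow> bool list" where
  "flip i x = x[i := \<not> x ! i]"

lemma length_flip [simp]: "length (flip i x) = length x"
  by (simp add: flip_def)

lemma nth_flip: "j < length x \<Longrightarrow> flip i x ! j = (if i = j then \<not> x ! j else x ! j)"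
  by (auto simp: flip_def nth_list_update)

lemma flip_flip [simp]: "flip i (flip i x) = x"
  by (rule nth_equalityI) (auto simp: nth_flip)

lemma flip_inject: "i < length x \<Longrightarrow> j < length x \<Longrightarrow> flip i x = flip j x \<longleftrightarrow> i = j"
  by (metis nth_flip)

lemma flip_edge_eq_iff:
  assumes "i < length y" "j < length y"
  shows "{x, flip i x} = {y, flip j y} \<longleftrightarrow> i = j \<and> (x = y \<or> x = flip i y)"
proof
  assume "{x, flip i x} = {y, flip j y}"
  then consider "x = y" "flip i x = flip j x" | "x = flip j y" "flip i x = flip j x"
    by (auto simp: doubleton_eq_iff)
  then show "i = j \<and> (x = y \<or> x = flip i y)"
    using flip_inject[of i x j] assms by cases auto
qed auto

lemma flip_append_left: "i < length x \<Longrightarrow> flip i (x @ y) = flip i x @ y"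
  and flip_append_right: "flip (length x + i) (x @ y) = x @ flip i y"
  by (simp_all add: flip_def list_update_append nth_append)

lemma verts_hypercube [simp]: "verts (hypercube n) = {x. length x = n}"
  by (simp add: hypercube_def)

lemma differ_once_iff_flip:
  assumes "length x = n" "length y = n"
  shows "(\<exists>!i. i < n \<and> x ! i \<noteq> y ! i) \<longleftrightarrow> (\<exists>i<n. y = flip i x)"
proof
  assume "\<exists>!i. i < n \<and> x ! i \<noteq> y ! i"
  then obtain i where i: "i < n" "x ! i \<noteq> y ! i" "\<And>j. j < n \<Longrightarrow> x ! j \<noteq> y ! j \<Longrightarrow> j = i"
    by blast
  have "y = flip i x"
  proof (rule nth_equalityI)
    fix j assume "j < length y"
    then show "y ! j = flip i x ! j" using i(2,3) assms by (metis nth_flip)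
  qed (use assms in simp)
  then show "\<exists>i<n. y = flip i x" using i(1) by blast
next
  assume "\<exists>i<n. y = flip i x"
  then obtain i where "i < n" "y = flip i x" by blast
  then show "\<exists>!i. i < n \<and> x ! i \<noteq> y ! i"
    using assms by (intro ex1I[of _ i]) (auto simp: nth_flip split: if_splits)
qed

lemma edges_hypercube: "edges (hypercube n) = {{x, flip i x} | x i. length x = n \<and> i < n}"
proof -
  have "edges (hypercube n) = {{x, y} | x y. length x = n \<and> length y = n \<and> (\<exists>i<n. y = flip i x)}"
    by (simp only: hypercube_def ugraph.simps differ_once_iff_flip cong: conj_cong)
  also have "\<dots> = {{x, flip i x} | x i. length x = n \<and> i < n}"
    using length_flip by blast
  finally show ?thesis .
qed

lemma edge_hypercubeE:
  assumes "e \<in> edges (hypercube n)"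
  obtains x i where "length x = n" "i < n" "e = {x, flip i x}"
  using assms by (auto simp: edges_hypercube)

lemma edge_in_hypercube: "i < length x \<Longrightarrow> length x = n \<Longrightarrow> {x, flip i x} \<in> edges (hypercube n)"
  unfolding edges_hypercube by blast

lemma finite_verts_hypercube: "finite {x :: bool list. length x = n}"
  and card_verts_hypercube: "card {x :: bool list. length x = n} = 2 ^ n"
  using finite_lists_length_eq[of "UNIV :: bool set" n]
    card_lists_length_eq[of "UNIV :: bool set" n]
  by auto

lemma degree_hypercube:
  assumes "length x = n"
  shows "degree (hypercube n) x = n"
proof -
  have "{e \<in> edges (hypercube n). x \<in> e} = (\<lambda>i. {x, flip i x}) ` {..<n}"
  proof (intro equalityI subsetI)
    fix e assume "e \<in> {e \<in> edges (hypercube n). x \<in> e}"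
    then obtain y i where y: "i < n" "e = {y, flip i y}" "x = y \<or> x = flip i y"
      by (auto elim: edge_hypercubeE)
    then have "e = {x, flip i x}" by (auto simp: insert_commute)
    then show "e \<in> (\<lambda>i. {x, flip i x}) ` {..<n}" using y(1) by simp
  qed (use assms edge_in_hypercube in auto)
  moreover have "inj_on (\<lambda>i. {x, flip i x}) {..<n}"
    using assms by (simp add: inj_on_def flip_edge_eq_iff)
  ultimately show ?thesis by (simp add: degree_def card_image)
qed

lemma card_edges_hypercube: "2 * card (edges (hypercube n)) = n * 2 ^ n"
  using sum_degree_eq[OF simple_graph_hypercube, of n]
  by (simp add: finite_verts_hypercube degree_hypercube card_verts_hypercube mult.commute)

lemma flip_edge_append_left:
  "i < length x \<Longrightarrow> (\<lambda>(x, y). x @ y) ` (\<lambda>x. (x, y)) ` {x, flip i x} = {x @ y, flip i (x @ y)}"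
  by (simp add: flip_append_left)

lemma flip_edge_append_right:
  "(\<lambda>(x, y). x @ y) ` Pair x ` {y, flip i y} = {x @ y, flip (length x + i) (x @ y)}"
  by (simp add: flip_append_right)

lemma edge_hypercube_add_imp_edge_product:
  assumes "e \<in> edges (hypercube (m + n))"
  shows "e \<in> image (\<lambda>(x, y). x @ y) ` edges (cartesian_product (hypercube m) (hypercube n))"
    (is "e \<in> image ?app ` edges ?P")
proof -
  obtain z i where z: "length z = m + n" "i < m + n" "e = {z, flip i z}"
    using assms by (rule edge_hypercubeE)
  define x y where "x = take m z" and "y = drop m z"
  have xy: "z = x @ y" "length x = m" "length y = n" using z(1) by (simp_all add: x_def y_def)
  show ?thesis
  proof (cases "i < m")
    case True
    then have "(\<lambda>x. (x, y)) ` {x, flip i x} \<in> edges ?P"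
      using xy by (intro edge_cartesian_product_leftI edge_in_hypercube) simp_all
    then show ?thesis using flip_edge_append_left[of i x y] True xy z(3) by blast
  next
    case False
    then obtain j where j: "i = m + j" "j < n"
      using z(2) by (metis add_less_cancel_left le_Suc_ex not_less)
    then have "Pair x ` {y, flip j y} \<in> edges ?P"
      using xy by (intro edge_cartesian_product_rightI edge_in_hypercube) simp_all
    then show ?thesis using flip_edge_append_right[of x y j] xy z(3) j(1) by blast
  qed
qed

lemma edge_product_imp_edge_hypercube_add:
  assumes "d \<in> edges (cartesian_product (hypercube m) (hypercube n))"
  shows "(\<lambda>(x, y). x @ y) ` d \<in> edges (hypercube (m + n))"
  using assms
proof (cases rule: edge_cartesian_productE)
  case (1 y c)
  then obtain x i where x: "length x = m" "i < m" "c = {x, flip i x}"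
    by (auto elim: edge_hypercubeE)
  then show ?thesis
    using 1 flip_edge_append_left[of i x y] edge_in_hypercube[of i "x @ y"] by simp
next
  case (2 x c)
  then obtain y i where y: "length y = n" "i < n" "c = {y, flip i y}"
    by (auto elim: edge_hypercubeE)
  then show ?thesis
    using 2 flip_edge_append_right[of x y i] edge_in_hypercube[of "m + i" "x @ y"] by simp
qed

lemma hypercube_add:
  "hypercube (m + n) = image_graph (\<lambda>(x, y). x @ y) (cartesian_product (hypercube m) (hypercube n))"
  (is "_ = image_graph ?app ?P")
proof (rule ugraph.equality)
  have "z \<in> ?app ` verts ?P" if "length z = m + n" for z :: "bool list"
    using that by (intro image_eqI[where x = "(take m z, drop m z)"]) auto
  then show "verts (hypercube (m + n)) = verts (image_graph ?app ?P)" by auto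
  show "edges (hypercube (m + n)) = edges (image_graph ?app ?P)"
    unfolding edges_image_graph
    using edge_hypercube_add_imp_edge_product edge_product_imp_edge_hypercube_add by blast
qed simp

lemma has_decomposition_hypercube_add:
  assumes "has_decomposition H (hypercube m)" "has_decomposition H (hypercube n)"
  shows "has_decomposition H (hypercube (m + n))"
  unfolding hypercube_add
  using assms by (intro has_decomposition_image_graph has_decomposition_cartesian_product)
    (auto simp: inj_on_def)

subsection \<open>Sunlets\<close>

fun sunlet_edge :: "nat \<Rightarrow> nat \<times> bool \<Rightarrow> (nat \<times> bool) set" where
  "sunlet_edge k (i, b) = {(i, False), if b then (i, True) else (Suc i mod k, False)}"

lemma verts_sunlet [simp]: "verts (sunlet k) = {..<k} \<times> UNIV"
  by (simp add: sunlet_def)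

lemma edges_sunlet: "edges (sunlet k) = sunlet_edge k ` verts (sunlet k)"
  by (auto simp: sunlet_def UNIV_bool image_iff)

lemma inj_on_sunlet_edge:
  assumes "k \<ge> 3"
  shows "inj_on (sunlet_edge k) (verts (sunlet k))"
proof -
  have no_2_cycle: "j \<noteq> Suc (Suc j mod k) mod k" if "j < k" for j
  proof
    assume "j = Suc (Suc j mod k) mod k"
    then have "Suc (Suc j) mod k = j" by (simp add: mod_Suc_eq)
    then show False using assms \<open>j < k\<close> by (auto simp: mod_Suc split: if_splits)
  qed
  then show ?thesis
    by (auto simp: inj_on_def doubleton_eq_iff split: if_splits)
qed

lemma card_edges_sunlet:
  assumes "k \<ge> 3"
  shows "card (edges (sunlet k)) = 2 * k"
proof -
  have "card (edges (sunlet k)) = card (verts (sunlet k))"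
    unfolding edges_sunlet using inj_on_sunlet_edge[OF assms] by (rule card_image)
  then show ?thesis by (simp add: card_cartesian_product)
qed

lemma degree_sunlet_cycle:
  assumes k: "k \<ge> 3" and i: "i < k"
  shows "3 \<le> degree (sunlet k) (i, False)"
proof -
  define j where "j = (if i = 0 then k - 1 else i - 1)"
  have j: "j < k" "Suc j mod k = i" "j \<noteq> i"
    using k i by (auto simp: j_def)
  let ?A = "{(i, False), (i, True), (j, False)}"
  have sub: "?A \<subseteq> verts (sunlet k)" using i j by simp
  have "3 = card ?A" using j by simp
  also have "\<dots> = card (sunlet_edge k ` ?A)"
    using inj_on_subset[OF inj_on_sunlet_edge[OF k] sub] by (rule card_image[symmetric])
  also have "\<dots> \<le> card {e \<in> edges (sunlet k). (i, False) \<in> e}"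
  proof (rule card_mono)
    show "sunlet_edge k ` ?A \<subseteq> {e \<in> edges (sunlet k). (i, False) \<in> e}"
      using image_mono[OF sub, of "sunlet_edge k"] j(2) by (auto simp: edges_sunlet)
  qed (simp add: edges_sunlet)
  finally show ?thesis by (simp add: degree_def)
qed

lemma card_verts_sunlet_degree_ge_3:
  assumes "k \<ge> 3"
  shows "k \<le> card {v \<in> verts (sunlet k). 3 \<le> degree (sunlet k) v}"
proof -
  have "{..<k} \<times> {False} \<subseteq> {v \<in> verts (sunlet k). 3 \<le> degree (sunlet k) v}"
    using degree_sunlet_cycle[OF assms] by auto
  then have "card ({..<k} \<times> {False}) \<le> card {v \<in> verts (sunlet k). 3 \<le> degree (sunlet k) v}"
    by (intro card_mono) simp_all
  then show ?thesis by (simp add: card_cartesian_product)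
qed

lemma sunlet_8_decomposition_imp_dimension:
  assumes "n \<ge> 1" and dec: "has_decomposition (sunlet 8) (hypercube n)"
  shows "n = 4 \<or> n \<ge> 6"
proof (rule ccontr)
  assume "\<not> ?thesis"
  then have n: "n \<in> {1, 2, 3, 5}" using \<open>n \<ge> 1\<close> by auto
  obtain D where D: "is_decomposition (sunlet 8) (hypercube n) D"
    using dec by (auto simp: has_decomposition_def)
  have "32 * card D = n * 2 ^ n"
    using card_edges_decomposition[OF D simple_graph_sunlet] card_edges_hypercube[of n]
    by (simp add: finite_verts_hypercube card_edges_sunlet)
  then have n_eq: "n = 5" and card_D: "card D = 5" using n by (auto, presburger+)
  have "card D * 8 \<le> card D * card {v \<in> verts (sunlet 8). 3 \<le> degree (sunlet 8) v}"
    by (intro mult_le_mono2 card_verts_sunlet_degree_ge_3) simp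
  also have "\<dots> \<le> card (verts (hypercube n))"
    using D by (rule card_decomposition_mult_high_degree_le)
      (simp_all add: simple_graph_sunlet finite_verts_hypercube degree_hypercube n_eq)
  finally show False by (simp add: card_verts_hypercube n_eq card_D)
qed

subsection \<open>Translates by a binary linear code\<close>

definition vec_add :: "bool list \<Rightarrow> bool list \<Rightarrow> bool list" (infixl "\<oplus>" 65) where
  "x \<oplus> y = map2 (\<noteq>) x y"

lemma length_vec_add [simp]: "length (x \<oplus> y) = min (length x) (length y)"
  by (simp add: vec_add_def)

lemma nth_vec_add: "i < length x \<Longrightarrow> i < length y \<Longrightarrow> (x \<oplus> y) ! i \<longleftrightarrow> x ! i \<noteq> y ! i"
  by (simp add: vec_add_def)

lemma vec_add_cancel_left: "length t = length x \<Longrightarrow> t \<oplus> (t \<oplus> x) = x"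
  by (rule nth_equalityI) (auto simp: nth_vec_add)

lemma vec_add_cancel_right: "length t = length x \<Longrightarrow> t \<oplus> x \<oplus> x = t"
  by (rule nth_equalityI) (auto simp: nth_vec_add)

lemma vec_add_flip: "length t = length x \<Longrightarrow> t \<oplus> flip i x = flip i (t \<oplus> x)"
  by (rule nth_equalityI) (auto simp: nth_flip nth_vec_add)

lemma inj_on_vec_add: "inj_on ((\<oplus>) t) {x. length x = length t}"
  by (rule inj_on_inverseI[where g = "(\<oplus>) t"]) (simp add: vec_add_cancel_left)

text \<open>A parity check matrix is given by the supports of its rows.\<close>

definition parity :: "bool list \<Rightarrow> nat list \<Rightarrow> bool" where
  "parity x r = foldr (\<lambda>i. (\<noteq>) (x ! i)) r False"

definition syndrome :: "nat list list \<Rightarrow> bool list \<Rightarrow> bool list" where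
  "syndrome M x = map (parity x) M"

definition linear_code :: "nat \<Rightarrow> nat list list \<Rightarrow> bool list set" where
  "linear_code n M = {t. length t = n \<and> (\<forall>r\<in>set M. \<not> parity t r)}"

lemma length_syndrome [simp]: "length (syndrome M x) = length M"
  by (simp add: syndrome_def)

lemma parity_vec_add:
  assumes "length x = n" "length y = n" "\<forall>i\<in>set r. i < n"
  shows "parity (x \<oplus> y) r \<longleftrightarrow> parity x r \<noteq> parity y r"
  using assms(3) by (induction r) (auto simp: parity_def nth_vec_add assms(1,2))

lemma syndrome_eq_iff:
  assumes "\<forall>r\<in>set M. \<forall>i\<in>set r. i < n" "length x = n" "length y = n"
  shows "syndrome M x = syndrome M y \<longleftrightarrow> x \<oplus> y \<in> linear_code n M"
  using assms by (auto simp: syndrome_def linear_code_def parity_vec_add)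

definition edge_ends :: "nat \<Rightarrow> bool list ugraph \<Rightarrow> bool list set" where
  "edge_ends i S = {x. {x, flip i x} \<in> edges S}"

lemma edge_ends_subset:
  assumes "subgraph S (hypercube n)"
  shows "edge_ends i S \<subseteq> {x. length x = n}"
  using assms simple_graphD(1)[OF simple_graph_hypercube]
  by (fastforce simp: edge_ends_def subgraph_def)

lemma has_decomposition_hypercube_if_edge_ends:
  assumes dec: "\<And>j. j \<in> J \<Longrightarrow> has_decomposition H (G j)"
    and sub: "\<And>j. j \<in> J \<Longrightarrow> subgraph (G j) (hypercube n)"
    and ex1: "\<And>x i. length x = n \<Longrightarrow> i < n \<Longrightarrow> \<exists>!j. j \<in> J \<and> x \<in> edge_ends i (G j)"
  shows "has_decomposition H (hypercube n)"
proof (rule has_decomposition_UN[where I = J and G = G])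
  fix j k assume jk: "j \<in> J" "k \<in> J" "j \<noteq> k"
  show "edges (G j) \<inter> edges (G k) = {}"
  proof (rule ccontr)
    assume "edges (G j) \<inter> edges (G k) \<noteq> {}"
    then obtain e where e: "e \<in> edges (G j)" "e \<in> edges (G k)" by auto
    then obtain x i where "length x = n" "i < n" "e = {x, flip i x}"
      using sub[OF jk(1)] by (meson edge_hypercubeE subgraph_def subsetD)
    then show False using ex1[of x i] e jk by (auto simp: edge_ends_def)
  qed
next
  show "(\<Union>j\<in>J. edges (G j)) = edges (hypercube n)"
  proof (intro equalityI subsetI)
    fix e assume "e \<in> edges (hypercube n)"
    then obtain x i where "length x = n" "i < n" "e = {x, flip i x}" by (rule edge_hypercubeE)
    then show "e \<in> (\<Union>j\<in>J. edges (G j))" using ex1[of x i] by (auto simp: edge_ends_def)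
  qed (use sub in \<open>auto simp: subgraph_def\<close>)
qed (use dec sub in \<open>auto simp: subgraph_def\<close>)

lemma subgraph_translate:
  assumes sub: "subgraph S (hypercube n)" and t: "length t = n"
  shows "subgraph (image_graph ((\<oplus>) t) S) (hypercube n)"
proof -
  have S: "simple_graph S" "verts S \<subseteq> {x. length x = n}" "edges S \<subseteq> edges (hypercube n)"
    using sub by (auto simp: subgraph_def)
  have "(\<oplus>) t ` e \<in> edges (hypercube n)" if "e \<in> edges (hypercube n)" for e
    using that by (elim edge_hypercubeE) (simp add: vec_add_flip t edge_in_hypercube)
  moreover have "inj_on ((\<oplus>) t) (verts S)"
    using inj_on_vec_add S(2) t by (auto intro: inj_on_subset)
  ultimately show ?thesis
    using S t by (auto simp: subgraph_def simple_graph_image_graph)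
qed

lemma edge_ends_translate:
  assumes sub: "subgraph S (hypercube n)" and "length t = n" "length x = n"
  shows "x \<in> edge_ends i (image_graph ((\<oplus>) t) S) \<longleftrightarrow> t \<oplus> x \<in> edge_ends i S"
proof -
  have "{x, flip i x} = (\<oplus>) t ` {t \<oplus> x, flip i (t \<oplus> x)}"
    using assms(2,3) by (simp add: vec_add_flip vec_add_cancel_left)
  moreover have "(\<oplus>) t ` {t \<oplus> x, flip i (t \<oplus> x)} \<in> image ((\<oplus>) t) ` edges S
      \<longleftrightarrow> {t \<oplus> x, flip i (t \<oplus> x)} \<in> edges S"
    using sub assms(2,3) by (intro image_mem_image_image_iff[OF inj_on_vec_add])
      (auto simp: subgraph_def dest: simple_graphD(1))
  ultimately show ?thesis by (simp add: edge_ends_def del: image_insert)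
qed

lemma ex1_translate_into_transversal:
  assumes M: "\<forall>r\<in>set M. \<forall>i\<in>set r. i < n"
    and E: "\<And>s. s \<in> I \<Longrightarrow> E s \<subseteq> {x. length x = n}"
    and bij: "bij_betw (\<lambda>(s, y). syndrome M y) (SIGMA s:I. E s) {\<sigma>. length \<sigma> = length M}"
    and x: "length x = n"
  shows "\<exists>!j. j \<in> I \<times> linear_code n M \<and> snd j \<oplus> x \<in> E (fst j)"
proof -
  have "syndrome M x \<in> (\<lambda>(s, y). syndrome M y) ` (SIGMA s:I. E s)"
    using bij_betw_imp_surj_on[OF bij] by simp
  then obtain s y where sy: "s \<in> I" "y \<in> E s" "syndrome M y = syndrome M x" by auto
  have uniq: "s' = s \<and> y' = y" if "s' \<in> I" "y' \<in> E s'" "syndrome M y' = syndrome M x" for s' y'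
    using inj_onD[OF bij_betw_imp_inj_on[OF bij], of "(s', y')" "(s, y)"] that sy by simp
  have y: "length y = n" using sy(1,2) E by auto
  show ?thesis
  proof (rule ex1I[of _ "(s, y \<oplus> x)"])
    have "y \<oplus> x \<in> linear_code n M" using syndrome_eq_iff[OF M y x] sy(3) by simp
    then show "(s, y \<oplus> x) \<in> I \<times> linear_code n M \<and> snd (s, y \<oplus> x) \<oplus> x \<in> E (fst (s, y \<oplus> x))"
      using sy x y by (simp add: vec_add_cancel_right)
  next
    fix j assume j: "j \<in> I \<times> linear_code n M \<and> snd j \<oplus> x \<in> E (fst j)"
    then obtain s' t where st: "j = (s', t)" "s' \<in> I" "t \<in> linear_code n M" "t \<oplus> x \<in> E s'"
      by auto
    then have t: "length t = n" "t \<oplus> x \<oplus> x = t"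
      using x by (simp_all add: linear_code_def vec_add_cancel_right)
    then have "syndrome M (t \<oplus> x) = syndrome M x"
      using syndrome_eq_iff[OF M _ x, of "t \<oplus> x"] st(3) x by simp
    then have "s' = s" "t \<oplus> x = y" using uniq[OF st(2,4)] by simp_all
    then show "j = (s, y \<oplus> x)" using t(2) st(1) by auto
  qed
qed

lemma has_decomposition_hypercube_if_translates:
  fixes G :: "'i \<Rightarrow> bool list ugraph"
  assumes M: "\<forall>r\<in>set M. \<forall>i\<in>set r. i < n"
    and dec: "\<And>s. s \<in> I \<Longrightarrow> has_decomposition H (G s)"
    and sub: "\<And>s. s \<in> I \<Longrightarrow> subgraph (G s) (hypercube n)"
    and bij: "\<And>i. i < n \<Longrightarrow>
      bij_betw (\<lambda>(s, x). syndrome M x) (SIGMA s:I. edge_ends i (G s)) {\<sigma>. length \<sigma> = length M}"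
  shows "has_decomposition H (hypercube n)"
proof (rule has_decomposition_hypercube_if_edge_ends)
  let ?J = "I \<times> linear_code n M"
  let ?G = "\<lambda>j. image_graph ((\<oplus>) (snd j)) (G (fst j))"
  have J: "fst j \<in> I" "length (snd j) = n" if "j \<in> ?J" for j
    using that by (auto simp: linear_code_def)
  show "has_decomposition H (?G j)" if "j \<in> ?J" for j
  proof (rule has_decomposition_image_graph[OF dec])
    show "inj_on ((\<oplus>) (snd j)) (verts (G (fst j)))"
      using inj_on_vec_add sub J[OF that] by (auto simp: subgraph_def intro: inj_on_subset)
  qed (rule J[OF that])
  show "subgraph (?G j) (hypercube n)" if "j \<in> ?J" for j
    using sub J[OF that] by (intro subgraph_translate)
  fix x :: "bool list" and i assume x: "length x = n" and i: "i < n"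
  have "j \<in> ?J \<and> x \<in> edge_ends i (?G j) \<longleftrightarrow> j \<in> ?J \<and> snd j \<oplus> x \<in> edge_ends i (G (fst j))" for j
    using edge_ends_translate[OF sub _ x] J by blast
  then show "\<exists>!j. j \<in> ?J \<and> x \<in> edge_ends i (?G j)"
    using ex1_translate_into_transversal[OF M edge_ends_subset[OF sub] bij[OF i] x] by simp
qed

subsection \<open>Explicit sunlets in the hypercube\<close>

text \<open>
  The triple \<open>(cs, ds, ps)\<close> stands for the sunlet whose cycle visits the vertices \<open>cs\<close>, leaving
  \<open>cs ! j\<close> in direction \<open>ds ! j\<close>, and whose pendant edge at \<open>cs ! j\<close> has direction \<open>ps ! j\<close>.
\<close>

type_synonym sun = "bool list list \<times> nat list \<times> nat list"

fun is_sun :: "nat \<Rightarrow> nat \<Rightarrow> sun \<Rightarrow> bool" where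
  "is_sun k n (cs, ds, ps) \<longleftrightarrow>
     length cs = k \<and> length ds = k \<and> length ps = k \<and>
     list_all (\<lambda>c. length c = n) cs \<and> list_all (\<lambda>i. i < n) ds \<and> list_all (\<lambda>i. i < n) ps \<and>
     rotate1 cs = map2 flip ds cs \<and> distinct (cs @ map2 flip ps cs)"

fun sun_vertex :: "sun \<Rightarrow> nat \<times> bool \<Rightarrow> bool list" where
  "sun_vertex (cs, ds, ps) (j, b) = (if b then flip (ps ! j) (cs ! j) else cs ! j)"

definition sun_graph :: "sun \<Rightarrow> bool list ugraph" where
  "sun_graph S = image_graph (sun_vertex S) (sunlet (length (fst S)))"

fun sun_steps :: "sun \<Rightarrow> (bool list \<times> nat) list" where
  "sun_steps (cs, ds, ps) = zip cs ds @ zip cs ps"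

lemma sun_steps_bounds:
  assumes "is_sun k n S" "(x, i) \<in> set (sun_steps S)"
  shows "length x = n" "i < n"
proof -
  obtain cs ds ps where S: "S = (cs, ds, ps)" by (cases S)
  have "x \<in> set cs" "i \<in> set ds \<union> set ps"
    using assms(2) by (auto simp: S dest: set_zip_leftD set_zip_rightD)
  then show "length x = n" "i < n"
    using assms(1) by (auto simp: S list_all_iff)
qed

lemma inj_on_sun_vertex:
  assumes "is_sun k n S"
  shows "inj_on (sun_vertex S) (verts (sunlet k))"
proof -
  obtain cs ds ps where S: "S = (cs, ds, ps)" by (cases S)
  define vs where "vs = cs @ map2 flip ps cs"
  have vs: "distinct vs" "length vs = k + k" and len: "length cs = k" "length ps = k"
    using assms by (auto simp: S vs_def)
  have "sun_vertex S (j, b) = vs ! (if b then k + j else j)" if "j < k" for j b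
    using that len by (simp add: S vs_def nth_append)
  then show ?thesis
    using vs by (auto simp: inj_on_def nth_eq_iff_index_eq split: if_splits)
qed

lemma edges_sun_graph:
  assumes "is_sun k n S"
  shows "edges (sun_graph S) = (\<lambda>(x, i). {x, flip i x}) ` set (sun_steps S)"
proof -
  obtain cs ds ps where S: "S = (cs, ds, ps)" by (cases S)
  have len: "length cs = k" "length ds = k" "length ps = k" and rot: "rotate1 cs = map2 flip ds cs"
    using assms by (auto simp: S)
  let ?step = "\<lambda>(j, b). (cs ! j, if b then ps ! j else ds ! j)"
  have "cs ! (Suc j mod k) = flip (ds ! j) (cs ! j)" if "j < k" for j
    using that len nth_rotate1[of j cs] by (simp add: rot)
  then have "sun_vertex S ` sunlet_edge k p = (\<lambda>(x, i). {x, flip i x}) (?step p)"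
    if "p \<in> verts (sunlet k)" for p
    using that by (cases p) (simp add: S)
  then have "edges (sun_graph S) = (\<lambda>(x, i). {x, flip i x}) ` ?step ` verts (sunlet k)"
    unfolding sun_graph_def edges_image_graph edges_sunlet image_image
    using len by (intro image_cong) (simp_all add: S)
  also have "verts (sunlet k) = (\<lambda>j. (j, False)) ` {..<k} \<union> (\<lambda>j. (j, True)) ` {..<k}"
    by (auto simp: UNIV_bool)
  also have "?step ` \<dots> = set (sun_steps S)"
    using len by (auto simp: S set_zip image_Un image_image)
  finally show ?thesis .
qed

lemma
  assumes S: "is_sun k n S" and k: "k \<ge> 3"
  shows subgraph_sun_graph: "subgraph (sun_graph S) (hypercube n)"
    and isomorphic_sun_graph: "isomorphic (sun_graph S) (sunlet k)"
proof -
  obtain cs ds ps where Seq: "S = (cs, ds, ps)" by (cases S)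
  have eq: "sun_graph S = image_graph (sun_vertex S) (sunlet k)"
    using S by (auto simp: Seq sun_graph_def)
  show "isomorphic (sun_graph S) (sunlet k)"
    unfolding eq using simple_graph_sunlet[OF k] inj_on_sun_vertex[OF S]
    by (rule isomorphic_image_graph)
  have "simple_graph (sun_graph S)"
    unfolding eq using simple_graph_sunlet[OF k] inj_on_sun_vertex[OF S]
    by (rule simple_graph_image_graph)
  moreover have "verts (sun_graph S) \<subseteq> verts (hypercube n)"
    unfolding eq using S by (auto simp: Seq list_all_length)
  moreover have "edges (sun_graph S) \<subseteq> edges (hypercube n)"
    using sun_steps_bounds[OF S] by (auto simp: edges_sun_graph[OF S] intro!: edge_in_hypercube)
  ultimately show "subgraph (sun_graph S) (hypercube n)" by (simp add: subgraph_def)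
qed

definition sun_edge_ends :: "nat \<Rightarrow> sun \<Rightarrow> bool list list" where
  "sun_edge_ends i S = concat (map (\<lambda>(x, j). if i = j then [x, flip i x] else []) (sun_steps S))"

lemma set_sun_edge_ends:
  assumes S: "is_sun k n S" and i: "i < n"
  shows "set (sun_edge_ends i S) = edge_ends i (sun_graph S)"
proof (rule set_eqI)
  fix x
  have "x \<in> edge_ends i (sun_graph S) \<longleftrightarrow>
      (\<exists>(y, j)\<in>set (sun_steps S). {x, flip i x} = {y, flip j y})"
    by (auto simp: edge_ends_def edges_sun_graph[OF S])
  also have "\<dots> \<longleftrightarrow> (\<exists>(y, j)\<in>set (sun_steps S). i = j \<and> (x = y \<or> x = flip i y))"
  proof (intro bex_cong refl, clarify)
    fix y j assume "(y, j) \<in> set (sun_steps S)"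
    then show "{x, flip i x} = {y, flip j y} \<longleftrightarrow> i = j \<and> (x = y \<or> x = flip i y)"
      using sun_steps_bounds[OF S] i by (intro flip_edge_eq_iff) simp_all
  qed
  also have "\<dots> \<longleftrightarrow> x \<in> set (sun_edge_ends i S)"
    by (auto simp: sun_edge_ends_def split: if_splits)
  finally show "x \<in> set (sun_edge_ends i S) \<longleftrightarrow> x \<in> edge_ends i (sun_graph S)" by (rule sym)
qed

lemma bij_betw_set_if_distinct_map:
  assumes "distinct (map f xs)" "f ` set xs \<subseteq> A" "length xs = card A" "finite A"
  shows "bij_betw f (set xs) A"
proof -
  have "card (f ` set xs) = card A"
    using assms(1,3) by (metis distinct_card length_map list.set_map)
  then show ?thesis
    using assms by (simp add: bij_betw_def distinct_map card_subset_eq)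
qed

definition sun_syndromes :: "nat list list \<Rightarrow> sun list \<Rightarrow> nat \<Rightarrow> bool list list" where
  "sun_syndromes M B i = concat (map (\<lambda>S. map (syndrome M) (sun_edge_ends i S)) B)"

definition is_sun_transversal :: "nat \<Rightarrow> nat \<Rightarrow> nat list list \<Rightarrow> sun list \<Rightarrow> bool" where
  "is_sun_transversal k n M B \<longleftrightarrow>
     list_all (list_all (\<lambda>i. i < n)) M \<and> list_all (is_sun k n) B \<and>
     list_all (\<lambda>i. distinct (sun_syndromes M B i) \<and>
       length (sun_syndromes M B i) = 2 ^ length M) [0..<n]"

lemma has_decomposition_if_sun_transversal:
  assumes "is_sun_transversal k n M B" and k: "k \<ge> 3"
  shows "has_decomposition (sunlet k) (hypercube n)"
proof (rule has_decomposition_hypercube_if_translates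
    [where M = M and I = "set B" and G = sun_graph])
  have sun: "is_sun k n S" if "S \<in> set B" for S
    using assms that by (simp add: is_sun_transversal_def list_all_iff)
  show "\<forall>r\<in>set M. \<forall>i\<in>set r. i < n"
    using assms by (simp add: is_sun_transversal_def list_all_iff)
  show sub: "subgraph (sun_graph S) (hypercube n)" if "S \<in> set B" for S
    using sun[OF that] k by (rule subgraph_sun_graph)
  show "has_decomposition (sunlet k) (sun_graph S)" if "S \<in> set B" for S
    using sub[OF that] isomorphic_sun_graph[OF sun[OF that] k]
    by (simp add: subgraph_def has_decomposition_if_isomorphic)
  fix i assume i: "i < n"
  let ?ends = "concat (map (\<lambda>S. map (Pair S) (sun_edge_ends i S)) B)"
  have syn: "map (\<lambda>(S, x). syndrome M x) ?ends = sun_syndromes M B i"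
    by (simp add: sun_syndromes_def map_concat comp_def)
  have "bij_betw (\<lambda>(S, x). syndrome M x) (set ?ends) {\<sigma>. length \<sigma> = length M}"
  proof (rule bij_betw_set_if_distinct_map)
    show "distinct (map (\<lambda>(S, x). syndrome M x) ?ends)"
      using assms i by (simp only: syn is_sun_transversal_def list_all_iff set_upt) simp
    have "length (sun_syndromes M B i) = 2 ^ length M"
      using assms i by (simp add: is_sun_transversal_def list_all_iff)
    then show "length ?ends = card {\<sigma> :: bool list. length \<sigma> = length M}"
      unfolding card_verts_hypercube syn[symmetric] by simp
  qed (auto simp: finite_verts_hypercube)
  moreover have "set ?ends = (SIGMA S:set B. edge_ends i (sun_graph S))"
    using set_sun_edge_ends[OF sun i] by auto
  ultimately show "bij_betw (\<lambda>(S, x). syndrome M x) (SIGMA S:set B. edge_ends i (sun_graph S))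
      {\<sigma>. length \<sigma> = length M}"
    by simp
qed

subsection \<open>Dimensions 4, 6, 7 and 9\<close>

fun walk :: "bool list \<Rightarrow> nat list \<Rightarrow> bool list list" where
  "walk x [] = []"
| "walk x (d # ds) = x # walk (flip d x) ds"

definition walk_sun :: "nat \<Rightarrow> nat list \<Rightarrow> nat list \<Rightarrow> nat list \<Rightarrow> sun" where
  "walk_sun n s ds ps = (walk (map (\<lambda>i. i \<in> set s) [0..<n]) ds, ds, ps)"

definition cyclic_shifts :: "nat \<Rightarrow> nat list \<Rightarrow> nat list \<Rightarrow> nat list \<Rightarrow> sun list" where
  "cyclic_shifts n s ds ps = map (\<lambda>a.
     let shift = map (\<lambda>i. (i + a) mod n) in walk_sun n (shift s) (shift ds) (shift ps)) [0..<n]"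

text \<open>
  The codes below are invariant under cyclic shifts for \<open>n = 6, 7, 9\<close>: the repetition code for
  \<open>n = 6, 7\<close>, and the words of period 3 for \<open>n = 9\<close>. This allows transversals made up of all
  cyclic shifts of one or two sunlets, found by a randomised computer search.
\<close>

lemma has_sunlet_8_decomposition_hypercube_4: "has_decomposition (sunlet 8) (hypercube 4)"
proof (rule has_decomposition_if_sun_transversal)
  show "is_sun_transversal 8 4 [[0, 1], [2], [3]]
    [walk_sun 4 [0] [2, 1, 3, 0, 2, 1, 3, 0] [3, 0, 2, 1, 3, 0, 2, 1]]"
    by code_simp
qed simp

lemma has_sunlet_8_decomposition_hypercube_6: "has_decomposition (sunlet 8) (hypercube 6)"
proof (rule has_decomposition_if_sun_transversal)
  show "is_sun_transversal 8 6 (map (\<lambda>i. [i, i + 1]) [0..<5])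
    (cyclic_shifts 6 [3, 5] [4, 5, 3, 0, 4, 3, 5, 0] [1, 3, 1, 4, 3, 1, 1, 4])"
    by code_simp
qed simp

lemma has_sunlet_8_decomposition_hypercube_7: "has_decomposition (sunlet 8) (hypercube 7)"
proof (rule has_decomposition_if_sun_transversal)
  show "is_sun_transversal 8 7 (map (\<lambda>i. [i, i + 1]) [0..<6])
    (cyclic_shifts 7 [2, 4, 6] [4, 1, 6, 5, 4, 6, 1, 5] [1, 2, 0, 2, 0, 0, 0, 6] @
     cyclic_shifts 7 [0, 2, 5] [6, 4, 0, 2, 6, 4, 0, 2] [5, 0, 1, 3, 3, 3, 5, 6])"
    by code_simp
qed simp

lemma has_sunlet_8_decomposition_hypercube_9: "has_decomposition (sunlet 8) (hypercube 9)"
proof (rule has_decomposition_if_sun_transversal)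
  show "is_sun_transversal 8 9 (map (\<lambda>i. [i, i + 3]) [0..<6])
    (cyclic_shifts 9 [2, 6, 7] [0, 3, 4, 2, 0, 2, 4, 3] [1, 4, 7, 7, 7, 5, 5, 5] @
     cyclic_shifts 9 [0, 7, 8] [7, 6, 1, 8, 1, 7, 6, 8] [6, 3, 0, 2, 5, 3, 2, 0])"
    by code_simp
qed simp

lemma has_sunlet_8_decomposition_hypercube:
  "n = 4 \<or> n \<ge> 6 \<Longrightarrow> has_decomposition (sunlet 8) (hypercube n)"
proof (induction n rule: less_induct)
  case (less n)
  show ?case
  proof (cases "n \<in> {4, 6, 7, 9}")
    case True
    then show ?thesis
      using has_sunlet_8_decomposition_hypercube_4 has_sunlet_8_decomposition_hypercube_6
        has_sunlet_8_decomposition_hypercube_7 has_sunlet_8_decomposition_hypercube_9 by auto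
  next
    case False
    then have "n - 4 < n" "n - 4 = 4 \<or> n - 4 \<ge> 6" and n: "4 + (n - 4) = n" using less.prems by auto
    then have "has_decomposition (sunlet 8) (hypercube (4 + (n - 4)))"
      using has_sunlet_8_decomposition_hypercube_4 less.IH
      by (intro has_decomposition_hypercube_add)
    then show ?thesis by (simp only: n)
  qed
qed

theorem theorem11:
  fixes n :: nat
  assumes "n \<ge> 1"
  shows "has_decomposition (sunlet 8) (hypercube n) \<longleftrightarrow> n = 4 \<or> n \<ge> 6"
proof
  assume "has_decomposition (sunlet 8) (hypercube n)"
  with assms show "n = 4 \<or> n \<ge> 6" by (rule sunlet_8_decomposition_imp_dimension)
next
  assume "n = 4 \<or> n \<ge> 6"
  then show "has_decomposition (sunlet 8) (hypercube n)"
    by (rule has_sunlet_8_decomposition_hypercube)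
qed

end
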